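(* Let $T$ be an $n\times n$ complex matrix with $\|T\|<1$ (operator norm), and let $\widehat{T}$ be a fractured Nelson dilation of $T$. Then $\widehat{T}$ is projection reducible if and only if $\widehat{T}$ is subspace reducible.
   Context: $\mathbb{D}$ is the open unit disk and $\mathbb{T}$ the unit circle in $\mathbb{C}$. Nelson dilation: Let $T$ be an $n\times n$ complex matrix with $\|T\|<1$. Write $T=U\,\mathrm{diag}(s_1,\dots,s_n)\,V^*$ with $U,V$ unitary and (phased) singular values $s_1,\dots,s_n\in\mathbb{D}$ (the $s_i$ may be complex). Let $b_1,\dots,b_n$ be automorphisms of $\mathbb{D}$, $b_i(z)=\lambda_i\frac{z+a_i}{1+\bar a_i z}$ with $\lambda_i\in\mathbb{T}$, $a_i\in\mathbb{D}$, such that $b_i(0)=s_i$ for all $i$. Any matrix-valued function of the form $\widehat{T}(z)=U\,\mathrm{diag}(b_1(z),\dots,b_n(z))\,V^*$ arising this way is called a Nelson dilation of $T$; it satisfies $\widehat{T}(0)=T$. Let $\mathbb{D}_T$ be the largest open disk centered at $0$ on which every $b_i$ is analytic (all of $\mathbb{C}$ if every $a_i=0$); then $\overline{\mathbb{D}}\subseteq\mathbb{D}_T$. The exceptional set of $\widehat{T}$ is $S_{\widehat{T}}=\{z\in\mathbb{D}_T:\widehat{T}(z)\text{ has a repeated eigenvalue}\}$, where a repeated eigenvalue is a multiple root of the characteristic polynomial. $\widehat{T}$ is called fractured if $S_{\widehat{T}}$ is finite. The eigenvalue function $\sigma(\widehat{T}(z))$ is the $n$-valued function on $\mathbb{D}_T$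 assigning to $z$ the $n$ roots, counted with multiplicity, of $\det(xI-\widehat{T}(z))=0$. For $z\in\mathbb{D}_T\setminus S_{\widehat{T}}$, with distinct eigenvalues $\lambda_1(z),\dots,\lambda_n(z)$, the eigenprojection associated to $\lambda_j(z)$ is the (not necessarily orthogonal) idempotent $P_j(z)=\frac{1}{2\pi i}\int_{\Gamma_j}(xI-\widehat{T}(z))^{-1}dx=\prod_{i\ne j}\frac{\widehat{T}(z)-\lambda_i(z)I}{\lambda_j(z)-\lambda_i(z)}$, where $\Gamma_j$ is a simple closed positively oriented curve enclosing $\lambda_j(z)$ and no other eigenvalue of $\widehat{T}(z)$. Given $1\le k\le n-1$ and a partition of $\sigma(\widehat{T}(z))$ into a $k$-valued function $\Lambda_1(z)$ and an $(n-k)$-valued function $\Lambda_2(z)$ on $\mathbb{D}_T$ (i.e. for each $z\in\mathbb{D}_T$, $\sigma(\widehat{T}(z))$ is the multiset union of the $k$-element multiset $\Lambda_1(z)$ and the $(n-k)$-element multiset $\Lambda_2(z)$), define for $\ell=1,2$ and $z\in\mathbb{D}_T\setminus S_{\widehat{T}}$: $P_{\Lambda_\ell}(z)=\sum_{j:\lambda_j(z)\in\Lambda_\ell(z)}P_j(z)$. A fractured Nelson dilation $\widehat{T}$ is projection reducible if there exist some $k$ with $1\le k\le n-1$ and such a partition $\Lambda_1,\Lambda_2$ so that both $P_{\Lambda_1}$ and $P_{\Lambda_2}$ extend analytically to $\mathbb{D}_T$ (i.e. each agrees on $\mathbb{D}_T\setminus S_{\widehat{T}}$ with a matrix-valued function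 analytic on $\mathbb{D}_T$). No continuity of $\Lambda_1,\Lambda_2$ is required. $\widehat{T}$ is subspace reducible if there is a subspace $S$ with $\{0\}\subsetneq S\subsetneq\mathbb{C}^n$ such that for every $z\in\mathbb{D}_T$, $S$ is invariant under both $\widehat{T}(z)$ and $\widehat{T}(z)^*$. *)

theory Defs
  imports
    "HOL-Complex_Analysis.Complex_Analysis"
    "HOL-Computational_Algebra.Computational_Algebra"
begin

subsection \<open>Matrices\<close>

definition ctranspose :: "complex^'n^'m \<Rightarrow> complex^'m^'n" where
  "ctranspose A = (\<chi> i j. cnj (A $ j $ i))"

definition unitary_matrix :: "complex^'n^'n \<Rightarrow> bool" where
  "unitary_matrix U \<longleftrightarrow> ctranspose U ** U = mat 1 \<and> U ** ctranspose U = mat 1"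

definition diag_matrix :: "('n \<Rightarrow> 'a::zero) \<Rightarrow> 'a^'n^'n" where
  "diag_matrix d = (\<chi> i j. if i = j then d i else 0)"

definition charpoly :: "complex^'n^'n \<Rightarrow> complex poly" where
  "charpoly A = det (mat [:0, 1:] - (\<chi> i j. [:A $ i $ j:]))"

definition eigenvalues :: "complex^'n^'n \<Rightarrow> complex multiset" where
  "eigenvalues A = proots (charpoly A)"

definition has_repeated_eigenvalue :: "complex^'n^'n \<Rightarrow> bool" where
  "has_repeated_eigenvalue A \<longleftrightarrow> (\<exists>x. order x (charpoly A) \<ge> 2)"

text \<open>
  The eigenprojection of \<open>A\<close> at \<open>l\<close> is the product of the matrices
  \<open>(A - \<mu> I) / (l - \<mu>)\<close> over the eigenvalues \<open>\<mu> \<noteq> l\<close>; it is only used when the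
  eigenvalues of \<open>A\<close> are distinct, and then it is the Riesz projection
  \<open>1 / (2 \<pi> i) \<integral> (x I - A)\<^sup>-\<^sup>1 dx\<close> over a curve enclosing \<open>l\<close> only.  Matrix multiplication is not commutative, so the
  product is written as a fold; the factors commute with each other, so the result does not
  depend on the order of multiplication.
\<close>

definition eigenprojection_factor ::
  "complex^'n^'n \<Rightarrow> complex \<Rightarrow> complex \<Rightarrow> complex^'n^'n" where
  "eigenprojection_factor A l \<mu> = mat (1 / (l - \<mu>)) ** (A - mat \<mu>)"

definition eigenprojection :: "complex^'n^'n \<Rightarrow> complex \<Rightarrow> complex^'n^'n" where
  "eigenprojection A l =
     Finite_Set.fold (\<lambda>\<mu> M. eigenprojection_factor A l \<mu> ** M) (mat 1)
       (set_mset (eigenvalues A) - {l})"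

lemma mat_mult_left: "mat c ** (A :: complex^'n^'n) = (\<chi> i j. c * A $ i $ j)"
  by (simp add: matrix_matrix_mult_def mat_def vec_eq_iff if_distrib [of "\<lambda>x. x * _"]
        cong: if_cong)

lemma mat_mult_right: "(A :: complex^'n^'n) ** mat c = (\<chi> i j. c * A $ i $ j)"
  by (simp add: matrix_matrix_mult_def mat_def vec_eq_iff if_distrib [of "\<lambda>x. _ * x"]
        mult.commute cong: if_cong)

lemma eigenprojection_factor_commute:
  "eigenprojection_factor A l \<mu> ** eigenprojection_factor A l \<nu> =
   eigenprojection_factor A l \<nu> ** eigenprojection_factor A l \<mu>"
proof -
  have diff_left: "(X - Y) ** Z = X ** Z - Y ** Z"
    and diff_right: "Z ** (X - Y) = Z ** X - Z ** Y" for X Y Z :: "complex^'n^'n"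
    by (simp_all add: matrix_matrix_mult_def vec_eq_iff left_diff_distrib right_diff_distrib
          sum_subtractf)
  have scalar: "X ** mat c = mat c ** X" for X :: "complex^'n^'n" and c
    unfolding mat_mult_left mat_mult_right ..
  have scalar': "X ** (mat c ** Y) = mat c ** (X ** Y)" for X Y :: "complex^'n^'n" and c
    by (metis matrix_mul_assoc scalar)
  have expand: "(A - mat x) ** (A - mat y) =
      A ** A - mat x ** A - (mat y ** A - mat x ** mat y)" for x y
    by (simp only: diff_left diff_right scalar [of A y])
  have comm: "(A - mat \<mu>) ** (A - mat \<nu>) = (A - mat \<nu>) ** (A - mat \<mu>)"
    unfolding expand scalar [of "mat \<nu>" \<mu>] by (simp add: algebra_simps)
  have factors: "eigenprojection_factor A l x ** eigenprojection_factor A l y =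
      mat (1 / (l - x)) ** (mat (1 / (l - y)) ** ((A - mat x) ** (A - mat y)))" for x y
    unfolding eigenprojection_factor_def
    by (metis matrix_mul_assoc scalar')
  show ?thesis
    unfolding factors comm by (rule scalar')
qed

lemma comp_fun_commute_eigenprojection_factor:
  "comp_fun_commute (\<lambda>\<mu> M. eigenprojection_factor A l \<mu> ** M)"
  by unfold_locales
     (simp add: fun_eq_iff matrix_mul_assoc eigenprojection_factor_commute)

definition analytic_matrix_on :: "(complex \<Rightarrow> complex^'n^'m) \<Rightarrow> complex set \<Rightarrow> bool" where
  "analytic_matrix_on G D \<longleftrightarrow> (\<forall>i j. (\<lambda>z. G z $ i $ j) analytic_on D)"


subsection \<open>Nelson dilations\<close>

definition disk_automorphism :: "(complex \<Rightarrow> complex) \<Rightarrow> bool" where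
  "disk_automorphism b \<longleftrightarrow>
     (\<exists>l a. cmod l = 1 \<and> cmod a < 1 \<and> b = (\<lambda>z. l * ((z + a) / (1 + cnj a * z))))"

definition nelson_function ::
  "complex^'n^'n \<Rightarrow> complex^'n^'n \<Rightarrow> ('n \<Rightarrow> complex \<Rightarrow> complex) \<Rightarrow> complex \<Rightarrow> complex^'n^'n"
where
  "nelson_function U V b z = U ** diag_matrix (\<lambda>i. b i z) ** ctranspose V"

text \<open>
  The data \<open>(U, V, b)\<close> of a Nelson dilation of \<open>T\<close>; the dilation itself is
  \<open>nelson_function U V b\<close>.
\<close>

definition nelson_data ::
  "complex^'n^'n \<Rightarrow> complex^'n^'n \<Rightarrow> complex^'n^'n \<Rightarrow> ('n \<Rightarrow> complex \<Rightarrow> complex) \<Rightarrow> bool"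
where
  "nelson_data T U V b \<longleftrightarrow>
     unitary_matrix U \<and> unitary_matrix V \<and>
     (\<exists>s. (\<forall>i. cmod (s i) < 1) \<and> T = U ** diag_matrix s ** ctranspose V \<and>
          (\<forall>i. disk_automorphism (b i) \<and> b i 0 = s i))"

text \<open>
  The largest open disk centred at \<open>0\<close> (possibly the whole plane) on which every \<open>b i\<close> is
  analytic.  Since \<open>x / 0 = 0\<close>, a disk automorphism with a pole is not even continuous
  there as a total function, so no disk in the union contains a pole.
\<close>

definition nelson_domain :: "('n \<Rightarrow> complex \<Rightarrow> complex) \<Rightarrow> complex set" where
  "nelson_domain b = \<Union> {ball 0 r | r. \<forall>i. b i analytic_on ball 0 r}"


subsection \<open>Reducibility\<close>

text \<open>In what follows, \<open>F\<close> is a matrix-valued function considered on the domain \<open>D\<close>.\<close>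

definition exceptional_set :: "complex set \<Rightarrow> (complex \<Rightarrow> complex^'n^'n) \<Rightarrow> complex set" where
  "exceptional_set D F = {z \<in> D. has_repeated_eigenvalue (F z)}"

definition fractured :: "complex set \<Rightarrow> (complex \<Rightarrow> complex^'n^'n) \<Rightarrow> bool" where
  "fractured D F \<longleftrightarrow> finite (exceptional_set D F)"

definition spectral_partition ::
  "complex set \<Rightarrow> (complex \<Rightarrow> complex^'n^'n) \<Rightarrow> nat \<Rightarrow>
   (complex \<Rightarrow> complex multiset) \<Rightarrow> (complex \<Rightarrow> complex multiset) \<Rightarrow> bool"
where
  "spectral_partition D F k \<Lambda>1 \<Lambda>2 \<longleftrightarrow>
     (\<forall>z\<in>D. eigenvalues (F z) = \<Lambda>1 z + \<Lambda>2 z \<and>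
            size (\<Lambda>1 z) = k \<and> size (\<Lambda>2 z) = CARD('n) - k)"

definition partition_projection ::
  "(complex \<Rightarrow> complex^'n^'n) \<Rightarrow> (complex \<Rightarrow> complex multiset) \<Rightarrow> complex \<Rightarrow> complex^'n^'n"
where
  "partition_projection F \<Lambda> z = (\<Sum>l\<in>set_mset (\<Lambda> z). eigenprojection (F z) l)"

definition extends_analytically ::
  "complex set \<Rightarrow> complex set \<Rightarrow> (complex \<Rightarrow> complex^'n^'n) \<Rightarrow> bool"
where
  "extends_analytically D S P \<longleftrightarrow>
     (\<exists>G. analytic_matrix_on G D \<and> (\<forall>z\<in>D - S. G z = P z))"

definition projection_reducible ::
  "complex set \<Rightarrow> (complex \<Rightarrow> complex^'n^'n) \<Rightarrow> bool"
where
  "projection_reducible D F \<longleftrightarrow>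
     (\<exists>k \<Lambda>1 \<Lambda>2. 1 \<le> k \<and> k \<le> CARD('n) - 1 \<and> spectral_partition D F k \<Lambda>1 \<Lambda>2 \<and>
        extends_analytically D (exceptional_set D F) (partition_projection F \<Lambda>1) \<and>
        extends_analytically D (exceptional_set D F) (partition_projection F \<Lambda>2))"

text \<open>
  Subspaces are complex subspaces, hence \<^const>\<open>vec.subspace\<close>;
  \<^const>\<open>subspace\<close> would refer to real scalars.
\<close>

definition subspace_reducible ::
  "complex set \<Rightarrow> (complex \<Rightarrow> complex^'n^'n) \<Rightarrow> bool"
where
  "subspace_reducible D F \<longleftrightarrow>
     (\<exists>S. vec.subspace S \<and> {0} \<subset> S \<and> S \<subset> UNIV \<and>
        (\<forall>z\<in>D. \<forall>v\<in>S. F z *v v \<in> S \<and> ctranspose (F z) *v v \<in> S))"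

end

theory Submission
  imports Defs
begin

text \<open>
  The values of a Nelson dilation on the unit circle are unitary, so there the eigenprojections
  are orthogonal projections.  If \<open>P\<^sub>\<Lambda>\<close> extends analytically, the extension is therefore Hermitian
  on the circle off a finite set, hence on the whole circle, and an analytic matrix function
  which is Hermitian on the circle is constant.  This constant \<open>Q\<close> commutes with the dilation and,
  being Hermitian, with its adjoints, so its fixed space is a reducing subspace.  Conversely,
  at a point with simple spectrum each eigenvector lies in a given reducing subspace or in its
  orthogonal complement, so the orthogonal projection onto the subspace is a (constant) sum of
  eigenprojections.
\<close>

unbundle no fps_syntax

subsection \<open>Eigenvalues and eigenprojections\<close>

lemma poly_det:
  fixes M :: "'a::comm_ring_1 poly^'n^'n"
  shows "poly (det M) x = det (\<chi> i j. poly (M $ i $ j) x)"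
  by (simp add: det_def poly_sum poly_prod)

lemma poly_charpoly: "poly (charpoly A) x = det (mat x - A)"
  unfolding charpoly_def poly_det
  by (rule arg_cong[of _ _ det]) (simp add: vec_eq_iff mat_def)

text \<open>In the Leibniz expansion the identity permutation contributes degree exactly
  \<open>CARD('n)\<close>. Any other permutation moves some index and so picks up a constant
  off-diagonal entry, which makes its degree strictly smaller.\<close>

lemma degree_charpoly: "degree (charpoly (A :: complex^'n^'n)) = CARD('n)"
proof -
  define M :: "complex poly^'n^'n" where "M = mat [:0, 1:] - (\<chi> i j. [:A $ i $ j:])"
  have M: "M $ i $ j = (if i = j then [:- A $ i $ i, 1:] else [:- A $ i $ j:])" for i j
    by (simp add: M_def mat_def)
  let ?t = "\<lambda>p. of_int (sign p) * (\<Prod>i\<in>UNIV. M $ i $ p i)"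
  let ?P = "{p. p permutes (UNIV :: 'n set)}"
  have id: "degree (?t id) = CARD('n)"
    by (subst degree_mult_eq) (simp_all add: M degree_prod_eq_sum_degree sign_id)
  have other: "degree (?t p) < CARD('n)" if "p \<noteq> id" for p
  proof -
    obtain i where i: "p i \<noteq> i"
      using \<open>p \<noteq> id\<close> by (auto simp: fun_eq_iff)
    have "degree (?t p) \<le> degree (\<Prod>i\<in>UNIV. M $ i $ p i)"
      using degree_mult_le[of "of_int (sign p)" "\<Prod>i\<in>UNIV. M $ i $ p i"] by simp
    also have "\<dots> \<le> (\<Sum>i\<in>UNIV. degree (M $ i $ p i))"
      using degree_prod_sum_le[of UNIV "\<lambda>i. M $ i $ p i"] by (simp add: o_def)
    also have "\<dots> < (\<Sum>i\<in>(UNIV :: 'n set). 1)"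
    proof (rule sum_strict_mono_ex1)
      show "\<exists>i\<in>UNIV. degree (M $ i $ p i) < 1"
        using i by (intro bexI[of _ i]) (auto simp: M)
    qed (auto simp: M)
    finally show ?thesis by simp
  qed
  have fin: "finite ?P" by (simp add: finite_permutations)
  have "charpoly A = ?t id + (\<Sum>p\<in>?P - {id}. ?t p)"
    unfolding charpoly_def M_def[symmetric] det_def
    by (rule sum.remove) (use fin in \<open>simp_all add: permutes_id\<close>)
  moreover have "degree (\<Sum>p\<in>?P - {id}. ?t p) < CARD('n)"
    using other by (intro degree_sum_less) auto
  ultimately show ?thesis
    using id by (simp add: degree_add_eq_left)
qed

lemma size_eigenvalues: "size (eigenvalues (A :: complex^'n^'n)) = CARD('n)"
  by (simp add: eigenvalues_def size_proots_complex degree_charpoly)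

lemma charpoly_nonzero: "charpoly (A :: complex^'n^'n) \<noteq> 0"
  using degree_charpoly[of A] by (metis degree_0 zero_less_card_finite less_irrefl)

lemma mat_mult_vec: "mat c *v (x :: complex^'n) = c *s x"
  by (simp add: matrix_vector_mult_def mat_def vec_eq_iff if_distrib [of "\<lambda>x. x * _"]
        cong: if_cong)

lemma mem_eigenvalues_iff:
  "l \<in># eigenvalues (A :: complex^'n^'n) \<longleftrightarrow> (\<exists>x. x \<noteq> 0 \<and> A *v x = l *s x)"
proof -
  have "l \<in># eigenvalues A \<longleftrightarrow> \<not> inj ((*v) (mat l - A))"
    using det_nz_iff_inj_gen[OF matrix_vector_mul_linear_gen, of "mat l - A"]
    by (auto simp: eigenvalues_def charpoly_nonzero poly_charpoly)
  also have "\<dots> \<longleftrightarrow> (\<exists>x. (mat l - A) *v x = 0 \<and> x \<noteq> 0)"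
    by (auto simp: vec.inj_iff_eq_0)
  finally show ?thesis
    by (auto simp: matrix_vector_mult_diff_rdistrib mat_mult_vec)
qed

text \<open>Each factor scales \<open>x\<close> by \<open>(m - \<mu>) / (l - \<mu>)\<close>. For
  \<open>m = l\<close> all these scalars are 1; otherwise \<open>m\<close> itself is one of the
  \<open>\<mu>\<close> and its factor kills \<open>x\<close>. All later facts about eigenprojections
  go through this action on eigenvectors.\<close>

lemma eigenprojection_mult_eigenvector:
  fixes A :: "complex^'n^'n"
  assumes x: "A *v x = m *s x" and m: "m \<in># eigenvalues A"
  shows "eigenprojection A l *v x = (if m = l then x else 0)"
proof -
  interpret comp_fun_commute "\<lambda>\<mu> M. eigenprojection_factor A l \<mu> ** M"
    by (rule comp_fun_commute_eigenprojection_factor)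
  have factor: "eigenprojection_factor A l \<mu> *v x = ((m - \<mu>) / (l - \<mu>)) *s x" for \<mu>
    by (simp add: eigenprojection_factor_def matrix_vector_mul_assoc[symmetric]
          mat_mult_vec matrix_vector_mult_diff_rdistrib x vec_eq_iff
          diff_divide_distrib left_diff_distrib)
  have fold: "Finite_Set.fold (\<lambda>\<mu> M. eigenprojection_factor A l \<mu> ** M) (mat 1) R *v x =
      (\<Prod>\<mu>\<in>R. (m - \<mu>) / (l - \<mu>)) *s x" if "finite R" for R
    using that
    by induction
      (simp_all add: fold_insert matrix_vector_mul_assoc[symmetric] vec.scale factor mult.commute)
  show ?thesis
    using m by (auto simp: eigenprojection_def fold intro!: prod.neutral prod_zero)
qed

lemma simple_spectrum:
  fixes A :: "complex^'n^'n"
  assumes "\<not> has_repeated_eigenvalue A"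
  shows count_eigenvalues_le: "count (eigenvalues A) l \<le> 1"
    and mset_set_eigenvalues: "mset_set (set_mset (eigenvalues A)) = eigenvalues A"
    and card_set_eigenvalues: "card (set_mset (eigenvalues A)) = CARD('n)"
proof -
  show le: "count (eigenvalues A) l \<le> 1" for l
    using assms
    by (auto simp: has_repeated_eigenvalue_def eigenvalues_def charpoly_nonzero not_le
          dest: spec[of _ l])
  show *: "mset_set (set_mset (eigenvalues A)) = eigenvalues A"
  proof (rule multiset_eqI)
    fix l
    show "count (mset_set (set_mset (eigenvalues A))) l = count (eigenvalues A) l"
      using le[of l] by (cases "l \<in># eigenvalues A") (auto simp: count_mset_set' not_in_iff le_antisym Suc_leI)
  qed
  show "card (set_mset (eigenvalues A)) = CARD('n)"
    by (metis * size_eigenvalues size_mset_set)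
qed

text \<open>Applying the eigenprojection at \<open>l\<close> to a vanishing combination of the
  chosen eigenvectors isolates the coefficient at \<open>l\<close>, which gives independence. With a
  simple spectrum there are \<open>CARD('n)\<close> of them, so they span.\<close>

lemma eigenbasis:
  fixes A :: "complex^'n^'n"
  assumes "\<not> has_repeated_eigenvalue A"
  obtains v where
    "\<And>l. l \<in># eigenvalues A \<Longrightarrow> v l \<noteq> 0"
    "\<And>l. l \<in># eigenvalues A \<Longrightarrow> A *v v l = l *s v l"
    "inj_on v (set_mset (eigenvalues A))"
    "vec.independent (v ` set_mset (eigenvalues A))"
    "vec.span (v ` set_mset (eigenvalues A)) = UNIV"
proof -
  let ?L = "set_mset (eigenvalues A)"
  obtain v where v: "\<And>l. l \<in> ?L \<Longrightarrow> v l \<noteq> 0 \<and> A *v v l = l *s v l"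
    using mem_eigenvalues_iff by metis
  have E: "eigenprojection A l *v v m = (if m = l then v m else 0)" if "m \<in> ?L" for l m
    using eigenprojection_mult_eigenvector v that by blast
  have inj: "inj_on v ?L"
    by (rule inj_onI) (metis E v)
  have indep: "vec.independent (v ` ?L)"
  proof (rule vec.independent_if_scalars_zero)
    fix f y assume sum: "(\<Sum>x\<in>v ` ?L. f x *s x) = 0" and "y \<in> v ` ?L"
    then obtain l where l: "l \<in> ?L" "y = v l" by blast
    have "0 = eigenprojection A l *v (\<Sum>m\<in>?L. f (v m) *s v m)"
      using sum by (simp add: sum.reindex[OF inj])
    also have "\<dots> = (\<Sum>m\<in>?L. f (v m) *s (eigenprojection A l *v v m))"
      by (simp add: vec.linear_sum[OF matrix_vector_mul_linear_gen] vec.scale)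
    also have "\<dots> = (\<Sum>m\<in>?L. if m = l then f y *s y else 0)"
      by (intro sum.cong) (auto simp: E l)
    also have "\<dots> = f y *s y"
      using l by simp
    finally show "f y = 0"
      using v l by simp
  qed simp
  have "UNIV \<subseteq> vec.span (v ` ?L)"
    using indep by (intro vec.card_ge_dim_independent)
      (simp_all add: card_image[OF inj] card_set_eigenvalues[OF assms] vec_dim_card del: vec.dim_UNIV)
  then show ?thesis
    using that[of v] v inj indep by auto
qed

lemma matrix_eqI_eigenvectors:
  fixes A M N :: "complex^'n^'n"
  assumes "\<not> has_repeated_eigenvalue A"
    and eq: "\<And>l x. \<lbrakk>l \<in># eigenvalues A; A *v x = l *s x\<rbrakk> \<Longrightarrow> M *v x = N *v x"
  shows "M = N"
proof -
  obtain v where v: "\<And>l. l \<in># eigenvalues A \<Longrightarrow> A *v v l = l *s v l"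
    and span: "vec.span (v ` set_mset (eigenvalues A)) = UNIV"
    using eigenbasis[OF assms(1)] by metis
  have "M *v x = N *v x" for x
  proof (rule vec.linear_eq_on[of "(*v) M" "(*v) N" x "v ` set_mset (eigenvalues A)"])
    show "x \<in> vec.span (v ` set_mset (eigenvalues A))" by (simp add: span)
  qed (use v eq in \<open>auto intro: matrix_vector_mul_linear_gen\<close>)
  then show ?thesis by (simp add: matrix_eq)
qed

text \<open>The eigenprojection at \<open>l\<close> maps the eigenbasis, hence everything, into the
  line through \<open>v l\<close>, and it fixes every eigenvector for \<open>l\<close>.\<close>

lemma eigenspace_one_dimensional:
  fixes A :: "complex^'n^'n"
  assumes A: "\<not> has_repeated_eigenvalue A" and x: "A *v x = l *s x" "x \<noteq> 0" and y: "A *v y = l *s y"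
  shows "\<exists>c. y = c *s x"
proof -
  let ?L = "set_mset (eigenvalues A)" and ?E = "eigenprojection A l"
  have l: "l \<in> ?L" using x mem_eigenvalues_iff by blast
  obtain v where v: "\<And>m. m \<in> ?L \<Longrightarrow> A *v v m = m *s v m"
    and span: "vec.span (v ` ?L) = UNIV"
    using eigenbasis[OF A] by metis
  have "?E *v z \<in> vec.span {v l}" for z
  proof -
    have "?E *v v m \<in> vec.span {v l}" if "m \<in> ?L" for m
      using eigenprojection_mult_eigenvector[OF v[OF that] that, of l]
      by (auto intro: vec.span_base vec.span_zero)
    then have "v ` ?L \<subseteq> {z. ?E *v z \<in> vec.span {v l}}" by blast
    moreover have "vec.subspace {z. ?E *v z \<in> vec.span {v l}}"
      by (auto simp: vec.subspace_def vec.scale vec.add intro: vec.span_zero vec.span_add vec.span_scale)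
    ultimately show ?thesis
      using span vec.span_minimal by blast
  qed
  then have "z \<in> vec.span {v l}" if "A *v z = l *s z" for z
    using eigenprojection_mult_eigenvector[OF that l, of l] by (metis (full_types))
  then obtain c d where "x = c *s v l" "y = d *s v l"
    using x y unfolding vec.span_singleton by blast
  then show ?thesis
    using x(2) by (intro exI[of _ "d / c"]) (auto simp: vec_eq_iff)
qed

lemma partition_projection_mult_eigenvector:
  assumes x: "F z *v x = m *s x" and m: "m \<in># eigenvalues (F z)"
  shows "partition_projection F \<Lambda> z *v x = (if m \<in># \<Lambda> z then x else 0)"
proof -
  have "(\<Sum>l\<in>S. M l) *v x = (\<Sum>l\<in>S. M l *v x)" for M :: "complex \<Rightarrow> complex^'a^'a" and S
    by (induction S rule: infinite_finite_induct) (simp_all add: matrix_vector_mult_add_rdistrib)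
  then show ?thesis
    by (simp add: partition_projection_def eigenprojection_mult_eigenvector[OF x m])
qed

subsection \<open>Unitary matrices\<close>

text \<open>
  The inner product \<open>\<bullet>\<close> on \<open>complex^'n\<close> is the real one, i.e. the real part of the Hermitian
  form.  On complex subspaces it defines the same orthogonality, since \<open>x \<bullet> (c *s y) = 0\<close> for
  all \<open>c\<close> forces the Hermitian product of \<open>x\<close> and \<open>y\<close> to vanish.
\<close>

lemma inner_scalar_left: "(c *s (x :: complex^'n)) \<bullet> y = x \<bullet> (cnj c *s y)"
  by (simp add: inner_vec_def inner_complex_def algebra_simps)

lemma inner_complex_Re: "x \<bullet> y = Re (x * cnj y)"
  by (simp add: inner_complex_def)

lemma inner_matrix_mult_left: "(A *v x) \<bullet> y = x \<bullet> (ctranspose A *v (y :: complex^'n))"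
proof -
  have "(A *v x) \<bullet> y = (\<Sum>i\<in>UNIV. \<Sum>j\<in>UNIV. Re (A $ i $ j * x $ j * cnj (y $ i)))"
    by (simp add: inner_vec_def inner_complex_Re matrix_vector_mult_def sum_distrib_right
          del: times_complex.sel)
  also have "\<dots> = (\<Sum>j\<in>UNIV. \<Sum>i\<in>UNIV. Re (A $ i $ j * x $ j * cnj (y $ i)))"
    by (rule sum.swap)
  also have "\<dots> = x \<bullet> (ctranspose A *v y)"
    by (simp add: inner_vec_def inner_complex_Re matrix_vector_mult_def ctranspose_def
          sum_distrib_left mult_ac del: times_complex.sel)
  finally show ?thesis .
qed

lemma ctranspose_ctranspose [simp]: "ctranspose (ctranspose A) = A"
  by (simp add: ctranspose_def vec_eq_iff)

lemma ctranspose_mult: "ctranspose (A ** B) = ctranspose B ** ctranspose A"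
  by (simp add: ctranspose_def vec_eq_iff matrix_matrix_mult_def mult.commute)

lemma unitary_matrix_ctranspose: "unitary_matrix U \<Longrightarrow> unitary_matrix (ctranspose U)"
  by (simp add: unitary_matrix_def)

lemma unitary_matrix_mult:
  assumes "unitary_matrix U" "unitary_matrix V"
  shows "unitary_matrix (U ** V)"
proof -
  have "ctranspose V ** ctranspose U ** (U ** V) = ctranspose V ** (ctranspose U ** U) ** V"
    "U ** V ** (ctranspose V ** ctranspose U) = U ** (V ** ctranspose V) ** ctranspose U"
    by (simp_all add: matrix_mul_assoc)
  with assms show ?thesis
    by (simp add: unitary_matrix_def ctranspose_mult)
qed

lemma unitary_matrix_diag:
  assumes "\<And>i. cmod (d i) = 1"
  shows "unitary_matrix (diag_matrix d)"
proof -
  have "d i * cnj (d i) = 1" "cnj (d i) * d i = 1" for i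
    using assms[of i] by (simp_all add: complex_norm_square[symmetric] mult.commute)
  then show ?thesis
    by (simp add: unitary_matrix_def diag_matrix_def ctranspose_def matrix_matrix_mult_def
          mat_def vec_eq_iff if_distrib[of cnj] if_distrib[of "\<lambda>x. x * _"] cong: if_cong)
qed

lemma unitary_inner: "unitary_matrix A \<Longrightarrow> (A *v x) \<bullet> (A *v y) = x \<bullet> y"
  by (simp add: inner_matrix_mult_left matrix_vector_mul_assoc unitary_matrix_def)

lemma unitary_eigenvectors_orthogonal:
  assumes A: "unitary_matrix A" and x: "A *v x = l *s x" and y: "A *v y = m *s y" and "l \<noteq> m"
  shows "x \<bullet> y = 0"
proof (cases "y = 0")
  case False
  have "y \<bullet> y = y \<bullet> ((cnj m * m) *s y)"
    using unitary_inner[OF A, of y y] by (simp add: y inner_scalar_left)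
  also have "\<dots> = (cmod m)\<^sup>2 * (y \<bullet> y)"
    by (simp add: complex_norm_square[symmetric] mult.commute[of "cnj m"]
        inner_vec_def inner_complex_def sum_distrib_left algebra_simps flip: of_real_power)
  finally have "m * cnj m = 1"
    using False by (simp add: complex_norm_square[symmetric])
  moreover from this have "m \<noteq> 0" by auto
  \<comment> \<open>As \<open>m\<close> has modulus one, \<open>cnj l * m = 1 = cnj m * m\<close>
    would give \<open>l = m\<close>.\<close>
  ultimately have ne: "1 - cnj l * m \<noteq> 0"
    using \<open>l \<noteq> m\<close>
    by (metis complex_cnj_cancel_iff complex_cnj_mult complex_cnj_one complex_cnj_cnj
        eq_iff_diff_eq_0 mult.commute mult_right_cancel)
  \<comment> \<open>Unitarity gives \<open>x \<bullet> (c (1 - cnj l * m) y) = 0\<close> for every \<open>c\<close>; this \<open>c\<close> turns it into the claim.\<close>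
  define c where "c = 1 / (1 - cnj l * m)"
  have "x \<bullet> (c *s y) = (A *v x) \<bullet> (A *v (c *s y))"
    by (rule unitary_inner[OF A, symmetric])
  also have "\<dots> = x \<bullet> ((cnj l * (m * c)) *s y)"
    by (simp add: x y vec.scale inner_scalar_left mult_ac)
  finally have "x \<bullet> (c *s y - (cnj l * (m * c)) *s y) = 0"
    by (simp add: inner_diff_right)
  also have "c *s y - (cnj l * (m * c)) *s y = (c * (1 - cnj l * m)) *s y"
    by (simp add: vec_eq_iff algebra_simps)
  finally show ?thesis
    using ne by (simp add: c_def)
qed simp

subsection \<open>Disk automorphisms and Nelson dilations\<close>

text \<open>On the circle \<open>cnj z\<close> is the inverse of \<open>z\<close>, so the
  denominator is \<open>z * cnj (z + a)\<close> and has the same modulus as the numerator.\<close>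

lemma disk_automorphism_circle:
  assumes "disk_automorphism b" "cmod z = 1"
  shows "cmod (b z) = 1"
proof -
  obtain l a where b: "cmod l = 1" "cmod a < 1" "b = (\<lambda>z. l * ((z + a) / (1 + cnj a * z)))"
    using assms(1) unfolding disk_automorphism_def by blast
  have "z * cnj z = 1"
    using assms(2) by (simp add: complex_norm_square[symmetric])
  then have "1 + cnj a * z = z * cnj (z + a)"
    by (simp add: algebra_simps)
  then have "cmod (1 + cnj a * z) = cmod (z + a)"
    using assms(2) by (metis complex_mod_cnj mult_1 norm_mult)
  \<comment> \<open>This excludes the quotient \<open>0 / 0\<close>, whose value 0 would have the
    wrong modulus.\<close>
  moreover have "z + a \<noteq> 0"
    using assms(2) b(2) by (metis add_eq_0_iff less_irrefl norm_minus_cancel)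
  ultimately show ?thesis
    using b by (simp add: norm_mult norm_divide)
qed

lemma disk_automorphism_analytic:
  assumes "disk_automorphism b"
  obtains r where "r > 1" "b analytic_on ball 0 r"
proof -
  obtain l a where b: "cmod l = 1" "cmod a < 1" "b = (\<lambda>z. l * ((z + a) / (1 + cnj a * z)))"
    using assms(1) unfolding disk_automorphism_def by blast
  \<comment> \<open>This radius exceeds 1 because \<open>cmod a < 1\<close>, yet
    \<open>cmod a * r = 2 * cmod a / (1 + cmod a) < 1\<close>, so any pole stays outside the
    ball.\<close>
  define r where "r = 2 / (1 + cmod a)"
  have r: "r > 1" "cmod a * r < 1"
    using b(2) add_pos_nonneg[OF zero_less_one norm_ge_zero[of a]] by (simp_all add: r_def field_simps)
  have "1 + cnj a * z \<noteq> 0" if "cmod z < r" for z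
  proof
    assume "1 + cnj a * z = 0"
    then have "cmod a * cmod z = 1"
      by (metis add_eq_0_iff complex_mod_cnj norm_minus_cancel norm_mult norm_one)
    moreover have "cmod a * cmod z \<le> cmod a * r"
      using that by (intro mult_left_mono) auto
    ultimately show False using r by simp
  qed
  then have "b analytic_on ball 0 r"
    unfolding b(3) by (intro analytic_intros) auto
  with r that show ?thesis by blast
qed

lemma nelson_domain_analytic: "b i analytic_on nelson_domain b"
  unfolding nelson_domain_def by (auto simp: analytic_on_Union)

lemma open_nelson_domain: "open (nelson_domain b)"
  unfolding nelson_domain_def by auto

lemma cball_subset_nelson_domain:
  fixes b :: "'n::finite \<Rightarrow> complex \<Rightarrow> complex"
  assumes "\<And>i. disk_automorphism (b i)"
  shows "cball 0 1 \<subseteq> nelson_domain b"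
proof -
  obtain r where r: "\<And>i. r i > 1 \<and> b i analytic_on ball 0 (r i)"
    by (meson disk_automorphism_analytic[OF assms])
  define R where "R = Min (range r)"
  have "R > 1" and "\<And>i. R \<le> r i"
    using r by (auto simp: R_def)
  moreover from this have "b i analytic_on ball 0 R" for i
    using r by (meson analytic_on_subset subset_ball)
  ultimately show ?thesis
    unfolding nelson_domain_def by (force intro!: exI[of _ "ball 0 R"])
qed

text \<open>A nonempty union of balls about 0 is starlike about 0. Since \<open>b\<close> is
  arbitrary here, the union may also be empty.\<close>

lemma connected_nelson_domain: "connected (nelson_domain b)"
proof (cases "nelson_domain b = {}")
  case False
  then obtain r where "r > 0" "\<forall>i. b i analytic_on ball 0 r"
    unfolding nelson_domain_def by (auto, metis dist_0_norm norm_ge_zero le_less_trans)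
  then have "0 \<in> nelson_domain b"
    unfolding nelson_domain_def by (auto intro!: exI[of _ "ball 0 r"])
  moreover have "closed_segment 0 x \<subseteq> nelson_domain b" if "x \<in> nelson_domain b" for x
  proof -
    obtain r where r: "x \<in> ball 0 r" "\<forall>i. b i analytic_on ball 0 r"
      using \<open>x \<in> nelson_domain b\<close> unfolding nelson_domain_def by blast
    then have "0 \<in> ball (0 :: complex) r"
      by (auto intro: le_less_trans[OF norm_ge_zero])
    with r have "closed_segment 0 x \<subseteq> ball 0 r"
      by (intro closed_segment_subset) auto
    with r(2) show ?thesis unfolding nelson_domain_def by blast
  qed
  ultimately show ?thesis
    by (intro starlike_imp_connected) (auto simp: starlike_def)
qed simp

lemma analytic_nelson_function:
  assumes "\<And>i. b i analytic_on D"
  shows "analytic_matrix_on (nelson_function U V b) D"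
proof -
  have "(\<lambda>z. \<Sum>k\<in>UNIV. U $ i $ k * b k z * cnj (V $ j $ k)) analytic_on D" for i j
    using assms by (intro analytic_intros) auto
  then show ?thesis
    by (simp add: analytic_matrix_on_def nelson_function_def matrix_matrix_mult_def
          diag_matrix_def ctranspose_def if_distrib[of "\<lambda>x. _ * x"] cong: if_cong)
qed

lemma unitary_nelson_function:
  assumes "unitary_matrix U" "unitary_matrix V" "\<And>i. cmod (b i z) = 1"
  shows "unitary_matrix (nelson_function U V b z)"
  unfolding nelson_function_def
  by (intro unitary_matrix_mult unitary_matrix_ctranspose unitary_matrix_diag assms)

subsection \<open>Analytic functions that are Hermitian on the circle\<close>

text \<open>A finite set has no limit points in a T1 space, so \<open>x\<close> is still a limit
  point of \<open>X - E\<close>, and continuity determines \<open>f x\<close>. This carries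
  identities across exceptional points, first on the circle and then on the whole domain.\<close>

lemma constant_extends_across_finite:
  fixes f :: "'a::t1_space \<Rightarrow> 'b::t2_space"
  assumes "continuous_on X f" "x \<in> X" "x islimpt X" "finite E" and eq: "\<And>y. y \<in> X - E \<Longrightarrow> f y = c"
  shows "f x = c"
proof (rule tendsto_unique)
  have "x islimpt (E \<union> (X - E))"
    using \<open>x islimpt X\<close> by (rule islimpt_subset) auto
  then have "x islimpt (X - E)"
    by (simp only: islimpt_Un_finite[OF \<open>finite E\<close>])
  then show "at x within (X - E) \<noteq> bot"
    by (simp add: trivial_limit_within)
  show "(f \<longlongrightarrow> f x) (at x within (X - E))"
    using assms(1,2) by (auto simp: continuous_on_def intro: tendsto_within_subset)
  show "(f \<longlongrightarrow> c) (at x within (X - E))"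
    by (rule tendsto_eventually) (auto simp: eventually_at_filter eq)
qed

text \<open>The maximum principle makes the imaginary part vanish on the disk. A nonconstant
  \<open>f\<close> would map the disk onto an open set, which cannot lie in the real line.\<close>

lemma analytic_real_on_circle_constant:
  assumes D: "open D" "connected D" "cball 0 1 \<subseteq> D"
    and f: "f analytic_on D" and real: "\<And>z. cmod z = 1 \<Longrightarrow> f z \<in> \<real>"
    and z: "z \<in> D"
  shows "f z = f 0"
proof -
  have hol: "f holomorphic_on D" by (rule analytic_imp_holomorphic[OF f])
  then have hol1: "f holomorphic_on cball 0 1" using D(3) by (rule holomorphic_on_subset)
  \<comment> \<open>The real parts of \<open>\<i> * f w\<close> and \<open>- \<i> * f w\<close> are
    \<open>- Im (f w)\<close> and \<open>Im (f w)\<close>, so the two choices of \<open>c\<close>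
    bound the imaginary part from both sides.\<close>
  have Re_le: "Re (c * f w) \<le> 0" if "c = \<i> \<or> c = - \<i>" "w \<in> cball 0 1" for c w
  proof (rule maximum_real_frontier[of "\<lambda>w. c * f w" "cball 0 1" 0 w])
    show "(\<lambda>w. c * f w) holomorphic_on interior (cball 0 1)"
      using hol1 by (intro holomorphic_intros) (auto intro: holomorphic_on_subset)
    show "continuous_on (closure (cball 0 1)) (\<lambda>w. c * f w)"
      using holomorphic_on_imp_continuous_on[OF hol1] by (auto intro!: continuous_intros)
    show "Re (c * f w) \<le> 0" if "w \<in> frontier (cball 0 1)" for w
      using real[of w] that \<open>c = \<i> \<or> c = - \<i>\<close> by (auto simp: complex_is_Real_iff)
  qed (use that in auto)
  have Im: "Im (f w) = 0" if "w \<in> ball 0 1" for w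
    using Re_le[of \<i> w] Re_le[of "- \<i>" w] that by auto
  have "f constant_on D"
  proof (rule ccontr)
    assume "\<not> f constant_on D"
    then have "open (f ` ball 0 1)"
      using D by (intro open_mapping_thm[OF hol]) auto
    then obtain e where "e > 0" "ball (f 0) e \<subseteq> f ` ball 0 1"
      by (meson centre_in_ball image_eqI openE zero_less_one)
    moreover have "f 0 + \<i> * of_real (e / 2) \<in> ball (f 0) e"
      using \<open>e > 0\<close> by (simp add: dist_norm norm_mult)
    ultimately have "Im (f 0 + \<i> * of_real (e / 2)) = 0"
      using Im by (metis (no_types, lifting) imageE subsetD)
    then show False using Im[of 0] \<open>e > 0\<close> by simp
  qed
  moreover have "0 \<in> D" using D(3) by auto
  ultimately show ?thesis using z unfolding constant_on_def by metis
qed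

text \<open>Single entries need not be real on the circle, but
  \<open>G z $ i $ j + G z $ j $ i\<close> and \<open>\<i> * (G z $ i $ j - G z $ j $ i)\<close>
  are. Both are therefore constant on \<open>D\<close>, and together they determine the
  entries.\<close>

lemma analytic_hermitian_on_circle_constant:
  fixes G :: "complex \<Rightarrow> complex^'n^'n"
  assumes D: "open D" "connected D" "cball 0 1 \<subseteq> D"
    and G: "analytic_matrix_on G D" and herm: "\<And>z. cmod z = 1 \<Longrightarrow> ctranspose (G z) = G z"
    and z: "z \<in> D"
  shows "G z = G 0"
proof -
  have an: "(\<lambda>z. G z $ i $ j) analytic_on D" for i j
    using G by (simp add: analytic_matrix_on_def)
  have cnj: "cnj (G z $ i $ j) = G z $ j $ i" if "cmod z = 1" for z i j
    using herm[OF that] by (simp add: ctranspose_def vec_eq_iff)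
  have "G z $ i $ j = G 0 $ i $ j" for i j
  proof -
    have "G z $ i $ j + G z $ j $ i = G 0 $ i $ j + G 0 $ j $ i"
      by (rule analytic_real_on_circle_constant[OF D _ _ z])
         (auto intro!: analytic_intros an simp: Reals_cnj_iff cnj)
    moreover have "\<i> * (G z $ i $ j - G z $ j $ i) = \<i> * (G 0 $ i $ j - G 0 $ j $ i)"
      by (rule analytic_real_on_circle_constant[OF D _ _ z])
         (auto intro!: analytic_intros an simp: Reals_cnj_iff cnj algebra_simps)
    ultimately show ?thesis unfolding mult_cancel_left by (auto simp: algebra_simps) algebra
  qed
  then show ?thesis by (simp add: vec_eq_iff)
qed

subsection \<open>Projection reducibility and subspace reducibility\<close>

lemma eigenvectors_span_UNIV:
  fixes A :: "complex^'n^'n"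
  assumes "\<not> has_repeated_eigenvalue A" "vec.subspace W"
    and "\<And>l x. \<lbrakk>l \<in># eigenvalues A; A *v x = l *s x\<rbrakk> \<Longrightarrow> x \<in> W"
  shows "x \<in> W"
proof -
  obtain v where "\<And>l. l \<in># eigenvalues A \<Longrightarrow> A *v v l = l *s v l"
    "vec.span (v ` set_mset (eigenvalues A)) = UNIV"
    using eigenbasis[OF assms(1)] by metis
  then show ?thesis
    using vec.span_minimal[OF _ assms(2)] assms(3) by blast
qed

lemma partition_projection_commute:
  assumes "\<not> has_repeated_eigenvalue (F z)"
  shows "F z ** partition_projection F \<Lambda> z = partition_projection F \<Lambda> z ** F z"
proof (rule matrix_eqI_eigenvectors[OF assms])
  fix l x assume l: "l \<in># eigenvalues (F z)" and x: "F z *v x = l *s x"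
  show "F z ** partition_projection F \<Lambda> z *v x = partition_projection F \<Lambda> z ** F z *v x"
    by (simp add: matrix_vector_mul_assoc[symmetric] x vec.scale
        partition_projection_mult_eigenvector[where F = F and z = z, OF x l])
qed

text \<open>On two eigenvectors with the same eigenvalue the projection acts by the same scalar, 0
  or 1; with different eigenvalues they are orthogonal by unitarity. The symmetry is then extended
  from eigenvectors to all vectors, one argument at a time.\<close>

lemma partition_projection_hermitian:
  fixes F :: "complex \<Rightarrow> complex^'n^'n"
  assumes simple: "\<not> has_repeated_eigenvalue (F z)" and unitary: "unitary_matrix (F z)"
  shows "ctranspose (partition_projection F \<Lambda> z) = partition_projection F \<Lambda> z"
proof -
  let ?Q = "partition_projection F \<Lambda> z"
  have eig: "(?Q *v x) \<bullet> y = x \<bullet> (?Q *v y)"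
    if "l \<in># eigenvalues (F z)" "F z *v x = l *s x" "m \<in># eigenvalues (F z)" "F z *v y = m *s y"
    for l m x y
    using unitary_eigenvectors_orthogonal[OF unitary that(2,4)]
      partition_projection_mult_eigenvector[where F = F and z = z and \<Lambda> = \<Lambda>, OF that(2,1)]
      partition_projection_mult_eigenvector[where F = F and z = z and \<Lambda> = \<Lambda>, OF that(4,3)]
    by (cases "l = m") auto
  have left: "(?Q *v x) \<bullet> y = x \<bullet> (?Q *v y)" if "m \<in># eigenvalues (F z)" "F z *v y = m *s y" for x y m
  proof -
    let ?W = "{x. \<forall>m y. m \<in># eigenvalues (F z) \<longrightarrow> F z *v y = m *s y \<longrightarrow> (?Q *v x) \<bullet> y = x \<bullet> (?Q *v y)}"
    have "vec.subspace ?W"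
      unfolding vec.subspace_def
    proof (intro conjI ballI allI)
      fix c x assume x: "x \<in> ?W"
      show "c *s x \<in> ?W"
      proof safe
        fix m y assume m: "m \<in># eigenvalues (F z)" and y: "F z *v y = m *s y"
        \<comment> \<open>The real inner product is not complex linear, so \<open>c\<close> is moved
          to the other side as \<open>cnj c\<close>. Rescaled eigenvectors are eigenvectors again,
          which is why \<open>?W\<close> quantifies over all of them.\<close>
        have "F z *v (cnj c *s y) = m *s (cnj c *s y)"
          by (simp add: vec.scale y mult.commute)
        with x m have "(?Q *v x) \<bullet> (cnj c *s y) = x \<bullet> (?Q *v (cnj c *s y))"
          by blast
        then show "(?Q *v (c *s x)) \<bullet> y = (c *s x) \<bullet> (?Q *v y)"
          by (simp add: vec.scale inner_scalar_left)
      qed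
    qed (auto simp: vec.add inner_add_left)
    then have "x \<in> ?W"
      by (rule eigenvectors_span_UNIV[OF simple]) (use eig in blast)
    with that show ?thesis by blast
  qed
  have "?Q *v y = ctranspose ?Q *v y" for y
  proof -
    have "vec.subspace {y. ?Q *v y = ctranspose ?Q *v y}"
      by (auto simp: vec.subspace_def vec.add vec.scale)
    then have "y \<in> {y. ?Q *v y = ctranspose ?Q *v y}"
    proof (rule eigenvectors_span_UNIV[OF simple])
      fix l x assume "l \<in># eigenvalues (F z)" "F z *v x = l *s x"
      then have "u \<bullet> (?Q *v x) = u \<bullet> (ctranspose ?Q *v x)" for u
        using left by (simp add: inner_matrix_mult_left)
      then show "x \<in> {y. ?Q *v y = ctranspose ?Q *v y}"
        using vector_eq_ldot by blast
    qed
    then show ?thesis by simp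
  qed
  then show ?thesis by (simp add: matrix_eq)
qed

lemma projection_reducible_imp_subspace_reducible:
  fixes F :: "complex \<Rightarrow> complex^'n^'n"
  assumes D: "open D" "connected D" "cball 0 1 \<subseteq> D"
    and F: "analytic_matrix_on F D" and unitary: "\<And>z. cmod z = 1 \<Longrightarrow> unitary_matrix (F z)"
    and fin: "finite (exceptional_set D F)" (is "finite ?E")
    and "projection_reducible D F"
  shows "subspace_reducible D F"
proof -
  obtain k \<Lambda>1 \<Lambda>2 G where k: "1 \<le> k" "k \<le> CARD('n) - 1" and part: "spectral_partition D F k \<Lambda>1 \<Lambda>2"
    and G: "analytic_matrix_on G D" and GP: "\<And>z. z \<in> D - ?E \<Longrightarrow> G z = partition_projection F \<Lambda>1 z"
    using \<open>projection_reducible D F\<close> unfolding projection_reducible_def extends_analytically_def by blast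
  have simple: "\<not> has_repeated_eigenvalue (F z)" if "z \<in> D - ?E" for z
    using that by (auto simp: exceptional_set_def)
  have contF: "continuous_on D (\<lambda>z. F z $ i $ j)" and contG: "continuous_on D (\<lambda>z. G z $ i $ j)" for i j
    using F G unfolding analytic_matrix_on_def
    by (blast intro: analytic_imp_holomorphic holomorphic_on_imp_continuous_on)+
  have herm: "ctranspose (G z) = G z" if "cmod z = 1" for z
  proof -
    have "cnj (G z $ j $ i) - G z $ i $ j = 0" for i j
    proof (rule constant_extends_across_finite[where X = "sphere 0 1" and E = ?E and x = z
          and f = "\<lambda>z. cnj (G z $ j $ i) - G z $ i $ j"])
      show "continuous_on (sphere 0 1) (\<lambda>z. cnj (G z $ j $ i) - G z $ i $ j)"
        using D(3) by (auto intro!: continuous_intros continuous_on_subset[OF contG])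
      \<comment> \<open>The circle is connected and has more than one point, so it has no isolated
        points.\<close>
      show "z islimpt sphere 0 1"
      proof (rule connected_imp_perfect)
        show "connected (sphere (0::complex) 1)" by (rule connected_sphere) simp
        have "1 \<in> sphere (0::complex) 1" "-1 \<in> sphere (0::complex) 1" by auto
        then show "sphere (0::complex) 1 \<noteq> {a}" for a
          by (metis one_neq_neg_one singletonD)
      qed (use that in auto)
    next
      fix y assume y: "y \<in> sphere 0 1 - ?E"
      then have "y \<in> D - ?E" using D(3) by auto
      then have "ctranspose (G y) = G y"
        using partition_projection_hermitian[OF simple unitary] y GP by auto
      then show "cnj (G y $ j $ i) - G y $ i $ j = 0"
        by (simp add: ctranspose_def vec_eq_iff)
    qed (use that fin in auto)
    then show ?thesis by (simp add: ctranspose_def vec_eq_iff)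
  qed
  define Q where "Q = G 0"
  have GQ: "G z = Q" if "z \<in> D" for z
    unfolding Q_def using analytic_hermitian_on_circle_constant[OF D G herm that] .
  have "ctranspose Q = Q"
    using herm[of 1] GQ[of 1] subsetD[OF D(3), of 1] by simp
  have comm: "F z ** Q = Q ** F z" if z: "z \<in> D" for z
  proof -
    have "(F z ** Q) $ i $ j - (Q ** F z) $ i $ j = 0" for i j
    proof (rule constant_extends_across_finite[where X = D and E = ?E and x = z
          and f = "\<lambda>z. (F z ** Q) $ i $ j - (Q ** F z) $ i $ j"])
      show "continuous_on D (\<lambda>z. (F z ** Q) $ i $ j - (Q ** F z) $ i $ j)"
        unfolding matrix_matrix_mult_def by (auto intro!: continuous_intros contF)
      show "z islimpt D"
        using z D(1) by (simp add: interior_limit_point interior_open)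
    next
      fix y assume y: "y \<in> D - ?E"
      then have "Q = partition_projection F \<Lambda>1 y" using GP GQ by auto
      then show "(F y ** Q) $ i $ j - (Q ** F y) $ i $ j = 0"
        using partition_projection_commute[where F = F and z = y, OF simple[OF y]] by simp
    qed (use z fin in auto)
    then show ?thesis by (simp add: vec_eq_iff)
  qed
  define S where "S = {x. Q *v x = x}"
  have sub: "vec.subspace S"
    by (auto simp: S_def vec.subspace_def vec.add vec.scale)
  \<comment> \<open>One non-exceptional point suffices to show that \<open>S\<close> is neither 0
    nor the whole space: as \<open>1 \<le> k < CARD('n)\<close>, both parts of the spectrum are
    nonempty there, and each supplies an eigenvector.\<close>
  have "infinite D"
    using D(1,3) finite_imp_not_open[of D] by force
  with fin have "infinite (D - ?E)" by (rule Diff_infinite_finite)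
  then obtain z where z: "z \<in> D - ?E"
    by (metis all_not_in_conv finite.emptyI)
  have Qz: "Q = partition_projection F \<Lambda>1 z"
    using z GP GQ by auto
  have size: "eigenvalues (F z) = \<Lambda>1 z + \<Lambda>2 z" "size (\<Lambda>1 z) = k" "size (\<Lambda>2 z) = CARD('n) - k"
    using part z by (auto simp: spectral_partition_def)
  then have "\<Lambda>1 z \<noteq> {#}" "\<Lambda>2 z \<noteq> {#}"
    using k by auto
  then obtain l m where l: "l \<in># \<Lambda>1 z" and m: "m \<in># \<Lambda>2 z" by blast
  then have le: "l \<in># eigenvalues (F z)" and me: "m \<in># eigenvalues (F z)" by (simp_all add: size)
  \<comment> \<open>An eigenvalue lying in both parts would have multiplicity at least 2.\<close>
  have m1: "m \<notin># \<Lambda>1 z"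
    using count_eigenvalues_le[OF simple[OF z], of m] m
    by (auto simp: size simp flip: count_greater_zero_iff)
  obtain x where x: "x \<noteq> 0" "F z *v x = l *s x" using le mem_eigenvalues_iff by blast
  obtain y where y: "y \<noteq> 0" "F z *v y = m *s y" using me mem_eigenvalues_iff by blast
  have "x \<in> S" "y \<notin> S"
    using partition_projection_mult_eigenvector[where F = F and z = z and \<Lambda> = \<Lambda>1, OF x(2) le]
      partition_projection_mult_eigenvector[where F = F and z = z and \<Lambda> = \<Lambda>1, OF y(2) me] y l m1
    by (simp_all add: S_def Qz)
  then have "{0} \<subset> S" "S \<subset> UNIV"
    using x(1) vec.subspace_0[OF sub] by auto
  moreover have "F w *v v \<in> S \<and> ctranspose (F w) *v v \<in> S" if "w \<in> D" "v \<in> S" for w v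
  proof -
    have "Q ** ctranspose (F w) = ctranspose (F w) ** Q"
      using arg_cong[OF comm[OF that(1)], of ctranspose] \<open>ctranspose Q = Q\<close>
      by (simp add: ctranspose_mult)
    then show ?thesis
      using comm[OF that(1)] that(2) by (simp add: S_def matrix_vector_mul_assoc) (metis matrix_vector_mul_assoc)
  qed
  ultimately show ?thesis
    unfolding subspace_reducible_def using sub by blast
qed

text \<open>The orthogonal projection is first obtained over the reals. It is the only map with
  these two properties, and since \<open>S\<close> is closed under complex scalars, uniqueness
  forces it to be complex linear, hence a matrix.\<close>

lemma subspace_orthogonal_decomposition:
  fixes S :: "(complex^'n) set"
  assumes S: "vec.subspace S"
  obtains Q where "\<And>x. Q *v x \<in> S" "\<And>x w. w \<in> S \<Longrightarrow> w \<bullet> (x - Q *v x) = 0"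
proof -
  have "(of_real c :: complex) *s x = c *\<^sub>R x" for c and x :: "complex^'n"
    by (simp add: vec_eq_iff scaleR_conv_of_real[where 'a = complex])
  then have real: "subspace S"
    using S unfolding subspace_def vec.subspace_def by metis
  have "\<exists>y\<in>S. \<forall>w\<in>S. w \<bullet> (x - y) = 0" for x
  proof -
    obtain y z where "y \<in> span S" "\<And>w. w \<in> span S \<Longrightarrow> orthogonal z w" "x = y + z"
      using orthogonal_subspace_decomp_exists[of S x] by blast
    moreover have "span S = S" using real by simp
    ultimately show ?thesis by (auto simp: orthogonal_def inner_commute intro!: bexI[of _ y])
  qed
  then obtain q where q: "\<And>x. q x \<in> S" "\<And>x w. w \<in> S \<Longrightarrow> w \<bullet> (x - q x) = 0" by metis
  have uniq: "q x = y" if "y \<in> S" "\<And>w. w \<in> S \<Longrightarrow> w \<bullet> (x - y) = 0" for x y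
  proof -
    have "q x - y \<in> S"
      using q(1) that(1) S by (simp add: vec.subspace_diff)
    then have "(q x - y) \<bullet> (x - y) - (q x - y) \<bullet> (x - q x) = 0"
      using q(2) that(2) by simp
    then have "(q x - y) \<bullet> (q x - y) = 0"
      by (simp add: inner_diff_right[symmetric])
    then show ?thesis by simp
  qed
  have "Vector_Spaces.linear (*s) (*s) q"
    unfolding Vector_Spaces.linear_iff
  proof (intro conjI allI vec.vector_space_axioms)
    fix x y
    show "q (x + y) = q x + q y"
    proof (rule uniq)
      fix w assume "w \<in> S"
      then show "w \<bullet> (x + y - (q x + q y)) = 0"
        using q(2)[of w x] q(2)[of w y] by (simp add: inner_diff_right inner_add_right)
    qed (use q(1) S in \<open>auto intro: vec.subspace_add\<close>)
  next
    fix c x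
    show "q (c *s x) = c *s q x"
    proof (rule uniq)
      fix w assume "w \<in> S"
      then have "cnj c *s w \<in> S" using S by (simp add: vec.subspace_scale)
      then have "(cnj c *s w) \<bullet> (x - q x) = 0" by (rule q(2))
      then show "w \<bullet> (c *s x - c *s q x) = 0"
        by (simp add: inner_scalar_left vec.scale_right_diff_distrib)
    qed (use q(1) S in \<open>auto intro: vec.subspace_scale\<close>)
  qed
  then have "matrix q *v x = q x" for x by (rule matrix_works)
  with q that show ?thesis by metis
qed

text \<open>Split \<open>x\<close> into \<open>y = Q *v x\<close> in \<open>S\<close> and
  \<open>w\<close> orthogonal to \<open>S\<close>. Both \<open>S\<close> and its complement are
  invariant, so \<open>y\<close> is again an eigenvector or 0; if it is nonzero, the one-dimensional
  eigenspace puts \<open>x\<close> into \<open>S\<close>.\<close>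

lemma reducing_subspace_eigenvector:
  fixes A :: "complex^'n^'n"
  assumes simple: "\<not> has_repeated_eigenvalue A" and S: "vec.subspace S"
    and inv: "\<And>x. x \<in> S \<Longrightarrow> A *v x \<in> S" "\<And>x. x \<in> S \<Longrightarrow> ctranspose A *v x \<in> S"
    and Q: "Q *v x \<in> S" "\<And>w. w \<in> S \<Longrightarrow> w \<bullet> (x - Q *v x) = 0"
    and x: "A *v x = l *s x"
  shows "Q *v x = x \<or> Q *v x = 0"
proof (cases "Q *v x = 0")
  case False
  define y where "y = Q *v x"
  define w where "w = x - y"
  have w: "u \<bullet> w = 0" if "u \<in> S" for u
    unfolding w_def y_def using that by (rule Q(2))
  \<comment> \<open>\<open>e\<close> lies in \<open>S\<close> and is orthogonal to \<open>S\<close>, so \<open>y\<close> is an eigenvector too.\<close>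
  define e where "e = A *v y - l *s y"
  have e: "e = l *s w - A *v w"
    by (simp add: e_def w_def vec.diff x vec.scale_right_diff_distrib)
  have "e \<in> S"
    unfolding e_def y_def by (intro vec.subspace_diff vec.subspace_scale S inv Q)
  then have "(cnj l *s e) \<bullet> w = 0" "(ctranspose A *v e) \<bullet> w = 0"
    by (auto intro!: w inv vec.subspace_scale[OF S])
  \<comment> \<open>Replacing the second \<open>e\<close> by \<open>l *s w - A *v w\<close> and
    moving \<open>l\<close> and \<open>A\<close> to the left leaves inner products of vectors of
    \<open>S\<close> with \<open>w\<close>. Invariance under the adjoint enters here.\<close>
  then have "e \<bullet> e = 0"
    by (subst (2) e) (simp add: inner_diff_right inner_scalar_left inner_matrix_mult_left)
  then have "A *v y = l *s y" by (simp add: e_def)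
  with eigenspace_one_dimensional[OF simple] x False obtain c where "x = c *s y"
    unfolding y_def by blast
  then have "x \<in> S" using vec.subspace_scale[OF S Q(1), of c] by (simp add: y_def)
  then have "x - Q *v x \<in> S" using Q(1) S by (simp add: vec.subspace_diff)
  then have "(x - Q *v x) \<bullet> (x - Q *v x) = 0" by (rule Q(2))
  then show ?thesis by simp
qed simp

lemma reducing_subspace_spectrum:
  fixes A :: "complex^'n^'n"
  assumes simple: "\<not> has_repeated_eigenvalue A" and S: "vec.subspace S"
    and inv: "\<And>x. x \<in> S \<Longrightarrow> A *v x \<in> S" "\<And>x. x \<in> S \<Longrightarrow> ctranspose A *v x \<in> S"
    and Q: "\<And>x. Q *v x \<in> S" "\<And>x w. w \<in> S \<Longrightarrow> w \<bullet> (x - Q *v x) = 0"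
  obtains \<Lambda>1 \<Lambda>2 where "eigenvalues A = \<Lambda>1 + \<Lambda>2"
    "size \<Lambda>1 = vec.dim S" "size \<Lambda>2 = CARD('n) - vec.dim S"
    "\<And>l x. \<lbrakk>l \<in># eigenvalues A; A *v x = l *s x\<rbrakk> \<Longrightarrow> Q *v x = (if l \<in># \<Lambda>1 then x else 0)"
    "\<And>l x. \<lbrakk>l \<in># eigenvalues A; A *v x = l *s x\<rbrakk> \<Longrightarrow> (mat 1 - Q) *v x = (if l \<in># \<Lambda>2 then x else 0)"
proof -
  \<comment> \<open>The first part of the spectrum consists of the eigenvalues whose eigenline lies
    in \<open>S\<close>; all other eigenlines are orthogonal to \<open>S\<close>.\<close>
  define P where "P l \<longleftrightarrow> (\<exists>x\<in>S. x \<noteq> 0 \<and> A *v x = l *s x)" for l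
  let ?\<Lambda>1 = "filter_mset P (eigenvalues A)" and ?\<Lambda>2 = "filter_mset (\<lambda>l. \<not> P l) (eigenvalues A)"
  have Q_S: "Q *v x = x" if "x \<in> S" for x
  proof -
    have "x - Q *v x \<in> S" using that Q(1) S by (simp add: vec.subspace_diff)
    then have "(x - Q *v x) \<bullet> (x - Q *v x) = 0" by (rule Q(2))
    then show ?thesis by simp
  qed
  have PQ: "Q *v x = (if P l then x else 0)" if x: "A *v x = l *s x" for l x
  proof (cases "P l")
    case True
    then obtain y c where "y \<in> S" "x = c *s y"
      using eigenspace_one_dimensional[OF simple _ _ x] unfolding P_def by blast
    then show ?thesis using True Q_S S by (simp add: vec.subspace_scale)
  next
    case False
    then have "Q *v x = x \<Longrightarrow> x = 0"
      using Q(1)[of x] x unfolding P_def by metis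
    then show ?thesis
      using reducing_subspace_eigenvector[OF simple S inv Q x] False by auto
  qed
  obtain v where v: "\<And>l. l \<in># eigenvalues A \<Longrightarrow> v l \<noteq> 0"
      "\<And>l. l \<in># eigenvalues A \<Longrightarrow> A *v v l = l *s v l"
    and inj: "inj_on v (set_mset (eigenvalues A))"
    and indep: "vec.independent (v ` set_mset (eigenvalues A))"
    and span: "vec.span (v ` set_mset (eigenvalues A)) = UNIV"
    using eigenbasis[OF simple] by metis
  let ?L = "{l \<in> set_mset (eigenvalues A). P l}"
  \<comment> \<open>The basis vectors \<open>v l\<close> with \<open>P l\<close> span
    \<open>S\<close>, because \<open>Q\<close> fixes \<open>S\<close> pointwise and sends every
    other \<open>v l\<close> to 0.\<close>
  have "vec.dim S = card (v ` ?L)"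
  proof (rule vec.dim_unique)
    show "v ` ?L \<subseteq> S"
    proof safe
      fix l assume "l \<in># eigenvalues A" "P l"
      then show "v l \<in> S" using PQ[OF v(2)] Q(1)[of "v l"] by simp
    qed
    show "vec.independent (v ` ?L)"
      by (rule vec.independent_mono[OF indep]) auto
    have "v ` set_mset (eigenvalues A) \<subseteq> {x. Q *v x \<in> vec.span (v ` ?L)}"
    proof safe
      fix l assume l: "l \<in># eigenvalues A"
      then have "P l \<Longrightarrow> v l \<in> vec.span (v ` ?L)"
        by (intro vec.span_base imageI) simp
      then show "Q *v v l \<in> vec.span (v ` ?L)"
        using PQ[OF v(2)[OF l]] vec.span_zero by (cases "P l") simp_all
    qed
    moreover have "vec.subspace {x. Q *v x \<in> vec.span (v ` ?L)}"
      by (auto simp: vec.subspace_def vec.add vec.scale intro: vec.span_zero vec.span_add vec.span_scale)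
    ultimately have "Q *v x \<in> vec.span (v ` ?L)" for x
      using vec.span_minimal span by blast
    then show "S \<subseteq> vec.span (v ` ?L)" by (metis Q_S subsetI)
  qed simp
  also have "\<dots> = card ?L"
    by (intro card_image inj_on_subset[OF inj]) auto
  also have "\<dots> = size ?\<Lambda>1"
    using arg_cong[OF mset_set_eigenvalues[OF simple], of "\<lambda>M. size (filter_mset P M)"]
    by (simp add: filter_mset_mset_set)
  finally have size1: "size ?\<Lambda>1 = vec.dim S" ..
  have part: "eigenvalues A = ?\<Lambda>1 + ?\<Lambda>2" by (rule multiset_partition)
  then have "size ?\<Lambda>1 + size ?\<Lambda>2 = CARD('n)"
    using size_eigenvalues[of A] by (metis size_union)
  then have size2: "size ?\<Lambda>2 = CARD('n) - vec.dim S"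
    using size1 by simp
  show ?thesis
  proof (rule that[OF part size1 size2])
    fix l x assume l: "l \<in># eigenvalues A" and x: "A *v x = l *s x"
    show "Q *v x = (if l \<in># ?\<Lambda>1 then x else 0)"
      "(mat 1 - Q) *v x = (if l \<in># ?\<Lambda>2 then x else 0)"
      using PQ[OF x] l by (simp_all add: matrix_vector_mult_diff_rdistrib)
  qed
qed

text \<open>The analytic extensions are the constants \<open>Q\<close> and \<open>mat 1 - Q\<close>.
  The part sizes do not vary with \<open>z\<close>, since the first one is always the dimension of
  \<open>S\<close>.\<close>

lemma subspace_reducible_imp_projection_reducible:
  fixes F :: "complex \<Rightarrow> complex^'n^'n"
  assumes "subspace_reducible D F"
  shows "projection_reducible D F"
proof -
  obtain S where S: "vec.subspace S" "{0} \<subset> S" "S \<subset> UNIV"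
    and inv: "\<And>z x. \<lbrakk>z \<in> D; x \<in> S\<rbrakk> \<Longrightarrow> F z *v x \<in> S" "\<And>z x. \<lbrakk>z \<in> D; x \<in> S\<rbrakk> \<Longrightarrow> ctranspose (F z) *v x \<in> S"
    using assms unfolding subspace_reducible_def by blast
  obtain Q where Q: "\<And>x. Q *v x \<in> S" "\<And>x w. w \<in> S \<Longrightarrow> w \<bullet> (x - Q *v x) = 0"
    using subspace_orthogonal_decomposition[OF S(1)] by metis
  let ?k = "vec.dim S"
  have "?k \<noteq> 0" using S by auto
  have "vec.dim S < vec.dim (UNIV :: (complex^'n) set)"
    using S by (intro vec.dim_psubset) (simp add: vec.span_eq_iff[THEN iffD2])
  then have k: "1 \<le> ?k" "?k \<le> CARD('n) - 1"
    using \<open>?k \<noteq> 0\<close> unfolding vec_dim_card by linarith+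
  let ?E = "exceptional_set D F"
  define R where "R z M N \<longleftrightarrow> eigenvalues (F z) = M + N \<and> size M = ?k \<and> size N = CARD('n) - ?k \<and>
      (z \<notin> ?E \<longrightarrow> (\<forall>l x. l \<in># eigenvalues (F z) \<longrightarrow> F z *v x = l *s x \<longrightarrow>
        Q *v x = (if l \<in># M then x else 0) \<and> (mat 1 - Q) *v x = (if l \<in># N then x else 0)))" for z M N
  have "\<exists>M N. R z M N" if z: "z \<in> D" for z
  proof (cases "z \<in> ?E")
    case True
    \<comment> \<open>At an exceptional point only the sizes of the parts are prescribed, so any
      split of the eigenvalues after \<open>?k\<close> entries will do.\<close>
    obtain xs where xs: "mset xs = eigenvalues (F z)" using ex_mset by blast
    then have "length xs = CARD('n)" by (metis size_mset size_eigenvalues)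
    then show ?thesis
      using True k xs unfolding R_def
      by (intro exI[of _ "mset (take ?k xs)"] exI[of _ "mset (drop ?k xs)"])
         (auto simp: mset_append[symmetric] simp del: mset_append)
  next
    case False
    then have "\<not> has_repeated_eigenvalue (F z)" using z by (simp add: exceptional_set_def)
    from reducing_subspace_spectrum[OF this S(1) inv[OF z] Q]
    obtain M N where "eigenvalues (F z) = M + N" "size M = ?k" "size N = CARD('n) - ?k"
      "\<And>l x. \<lbrakk>l \<in># eigenvalues (F z); F z *v x = l *s x\<rbrakk> \<Longrightarrow> Q *v x = (if l \<in># M then x else 0)"
      "\<And>l x. \<lbrakk>l \<in># eigenvalues (F z); F z *v x = l *s x\<rbrakk> \<Longrightarrow> (mat 1 - Q) *v x = (if l \<in># N then x else 0)"
      by blast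
    then have "R z M N" by (simp add: R_def)
    then show ?thesis by blast
  qed
  then obtain M N where R: "\<And>z. z \<in> D \<Longrightarrow> R z (M z) (N z)" by metis
  have simple: "\<not> has_repeated_eigenvalue (F z)" if "z \<in> D - ?E" for z
    using that by (auto simp: exceptional_set_def)
  have "Q = partition_projection F M z" and "mat 1 - Q = partition_projection F N z"
    if z: "z \<in> D - ?E" for z
  proof -
    have eq: "Q *v x = partition_projection F M z *v x \<and> (mat 1 - Q) *v x = partition_projection F N z *v x"
      if "l \<in># eigenvalues (F z)" "F z *v x = l *s x" for l x
      using R[of z] z that unfolding R_def
      by (simp add: partition_projection_mult_eigenvector[where F = F and z = z, OF that(2,1)])
    show "Q = partition_projection F M z" "mat 1 - Q = partition_projection F N z"
      using eq by (blast intro: matrix_eqI_eigenvectors[OF simple[OF z]])+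
  qed
  moreover have "analytic_matrix_on (\<lambda>z. C) D" for C :: "complex^'n^'n"
    by (simp add: analytic_matrix_on_def)
  ultimately have "extends_analytically D ?E (partition_projection F M)"
    "extends_analytically D ?E (partition_projection F N)"
    unfolding extends_analytically_def by metis+
  moreover have "spectral_partition D F ?k M N"
    using R by (simp add: spectral_partition_def R_def)
  ultimately show ?thesis
    using k unfolding projection_reducible_def by blast
qed

theorem theorem3p5:
  fixes T U V :: "complex^'n^'n" and b :: "'n \<Rightarrow> complex \<Rightarrow> complex"
  assumes "onorm (\<lambda>x. T *v x) < 1"
    and "nelson_data T U V b"
    and "fractured (nelson_domain b) (nelson_function U V b)"
  shows "projection_reducible (nelson_domain b) (nelson_function U V b) \<longleftrightarrow>
         subspace_reducible (nelson_domain b) (nelson_function U V b)"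
proof
  have U: "unitary_matrix U" "unitary_matrix V" and b: "\<And>i. disk_automorphism (b i)"
    using assms(2) by (auto simp: nelson_data_def)
  have "unitary_matrix (nelson_function U V b z)" if "cmod z = 1" for z
    using U disk_automorphism_circle[OF b that] by (rule unitary_nelson_function)
  moreover assume "projection_reducible (nelson_domain b) (nelson_function U V b)"
  moreover have "cball 0 1 \<subseteq> nelson_domain b"
    by (rule cball_subset_nelson_domain[OF b])
  ultimately show "subspace_reducible (nelson_domain b) (nelson_function U V b)"
    using assms(3) unfolding fractured_def
    by (intro projection_reducible_imp_subspace_reducible open_nelson_domain
        connected_nelson_domain analytic_nelson_function nelson_domain_analytic)
qed (rule subspace_reducible_imp_projection_reducible)

end
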